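(* Let $G$ be an $(n-3)$-regular graph on $n$ vertices. Then $G$ has an internal partition if and only if its complement $\bar G$ (which is $2$-regular, hence a disjoint union of cycles) has at most one odd cycle. Moreover, in that case $G$ has an internal partition $(A,B)$ that is a near-bisection, i.e. $||A|-|B||\le 1$.
   Context: Graphs are finite and simple; $\bar G$ is the complement of $G$. For $S\subseteq V$, $d_S(v)$ is the number of neighbors of $v$ in $S$ and $d(v)$ the degree of $v$. An internal partition is a partition $V=A\dot\cup B$ with $A,B\ne\emptyset$ such that $d_A(x)\ge d(x)/2$ for all $x\in A$ and $d_B(x)\ge d(x)/2$ for all $x\in B$. *)

theory Defs
  imports Complex_Main
begin

text \<open>A graph is a pair of a vertex set and a set of edges, the edges being
  two-element sets of vertices.\<close>

definition all_pairs :: "'a set \<Rightarrow> 'a set set" where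
  "all_pairs V = {e. e \<subseteq> V \<and> card e = 2}"

definition simple_graph :: "'a set \<Rightarrow> 'a set set \<Rightarrow> bool" where
  "simple_graph V E \<longleftrightarrow> finite V \<and> E \<subseteq> all_pairs V"

definition complement_edges :: "'a set \<Rightarrow> 'a set set \<Rightarrow> 'a set set" where
  "complement_edges V E = all_pairs V - E"

definition deg_in :: "'a set set \<Rightarrow> 'a set \<Rightarrow> 'a \<Rightarrow> nat" where
  "deg_in E S v = card {u \<in> S. {v, u} \<in> E}"

definition k_regular :: "'a set \<Rightarrow> 'a set set \<Rightarrow> nat \<Rightarrow> bool" where
  "k_regular V E k \<longleftrightarrow> (\<forall>v\<in>V. deg_in E V v = k)"

definition internal_partition ::
    "'a set \<Rightarrow> 'a set set \<Rightarrow> 'a set \<Rightarrow> 'a set \<Rightarrow> bool" where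
  "internal_partition V E A B \<longleftrightarrow>
     A \<union> B = V \<and> A \<inter> B = {} \<and> A \<noteq> {} \<and> B \<noteq> {} \<and>
     (\<forall>x\<in>A. real (deg_in E A x) \<ge> real (deg_in E V x) / 2) \<and>
     (\<forall>x\<in>B. real (deg_in E B x) \<ge> real (deg_in E V x) / 2)"

definition near_bisection :: "'a set \<Rightarrow> 'a set \<Rightarrow> bool" where
  "near_bisection A B \<longleftrightarrow> \<bar>int (card A) - int (card B)\<bar> \<le> 1"

text \<open>A cycle is identified with its edge set \<open>C\<close>, so that rotations and reversals
  of a cyclic vertex sequence give the same cycle. Its vertex set is \<open>\<Union>C\<close> and its
  length is \<open>card C\<close>.\<close>

definition cycle_edges :: "'a list \<Rightarrow> 'a set set" where
  "cycle_edges vs = {{vs ! i, vs ! (Suc i mod length vs)} | i. i < length vs}"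

definition cycle_of :: "'a set set \<Rightarrow> 'a set set \<Rightarrow> bool" where
  "cycle_of E C \<longleftrightarrow>
     C \<subseteq> E \<and> (\<exists>vs. distinct vs \<and> 3 \<le> length vs \<and> C = cycle_edges vs)"

definition odd_cycle_of :: "'a set set \<Rightarrow> 'a set set \<Rightarrow> bool" where
  "odd_cycle_of E C \<longleftrightarrow> cycle_of E C \<and> odd (card C)"

definition disjoint_union_of_cycles :: "'a set \<Rightarrow> 'a set set \<Rightarrow> bool" where
  "disjoint_union_of_cycles V E \<longleftrightarrow>
     (\<exists>\<C>. (\<forall>C\<in>\<C>. cycle_of E C) \<and>
          pairwise (\<lambda>C D. disjnt (\<Union>C) (\<Union>D)) \<C> \<and>
          \<Union>\<C> = E \<and> \<Union>(\<Union>\<C>) = V)"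

end

theory Submission
  imports Defs
begin

text \<open>
  Let \<open>F\<close> be the complement of \<open>E\<close>, a 2-regular graph, and write \<open>f\<^sub>S(x)\<close> for the number of
  \<open>F\<close>-neighbours of \<open>x\<close> in \<open>S\<close>. A partition \<open>(A, B)\<close> is internal iff
  \<open>|B| + 2 f\<^sub>A(x) \<le> |A| + 1\<close> on \<open>A\<close> and \<open>|A| + 2 f\<^sub>B(x) \<le> |B| + 1\<close> on \<open>B\<close>.
  If \<open>|A| \<le> |B|\<close>, this forces \<open>f\<^sub>A = 0\<close> on \<open>A\<close> and \<open>|B| \<le> |A| + 1\<close>; double counting the
  \<open>F\<close>-edges between \<open>A\<close> and \<open>B\<close> then shows that the sum of \<open>f\<^sub>B\<close> over \<open>B\<close> is
  \<open>2(|B| - |A|) \<le> 2\<close>, so at most one \<open>F\<close>-edge lies inside \<open>B\<close>. Since every odd cycle has an edge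
  inside \<open>A\<close> or inside \<open>B\<close> and distinct cycles are disjoint, there is at most one odd cycle.
  Conversely, colouring each cycle alternately, with the surplus vertex of an odd cycle put
  into \<open>B\<close>, gives a partition with the required properties.
\<close>

section \<open>Degrees into a set and the complement form of internality\<close>

lemma deg_in_Un:
  assumes "finite A" "finite B" "A \<inter> B = {}"
  shows "deg_in F (A \<union> B) x = deg_in F A x + deg_in F B x"
proof -
  have "{u \<in> A \<union> B. {x, u} \<in> F} = {u \<in> A. {x, u} \<in> F} \<union> {u \<in> B. {x, u} \<in> F}"
    by blast
  then show ?thesis
    unfolding deg_in_def using assms by (simp add: card_Un_disjoint disjoint_iff)
qed

lemma deg_in_pos:
  assumes "finite S" "y \<in> S" "{x, y} \<in> F"
  shows "deg_in F S x > 0"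
  unfolding deg_in_def using assms by (auto simp: card_gt_0_iff)

lemma sum_deg_in_commute:
  assumes "finite A" "finite B"
  shows "(\<Sum>x\<in>A. deg_in F B x) = (\<Sum>y\<in>B. deg_in F A y)"
proof -
  have deg: "deg_in F S x = (\<Sum>y\<in>S. if {x, y} \<in> F then 1 else 0)" if "finite S" for S x
    unfolding deg_in_def using that by (simp add: sum.If_cases Int_def)
  have "(\<Sum>x\<in>A. deg_in F B x) = (\<Sum>y\<in>B. \<Sum>x\<in>A. if {x, y} \<in> F then 1 else 0)"
    unfolding deg[OF assms(2)] by (rule sum.swap)
  also have "\<dots> = (\<Sum>y\<in>B. deg_in F A y)"
    unfolding deg[OF assms(1)] by (simp add: insert_commute)
  finally show ?thesis .
qed

text \<open>Each vertex of \<open>S\<close> other than \<open>x\<close> is joined to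
  \<open>x\<close> in exactly one of the two graphs; the \<open>+ 1\<close> accounts for
  \<open>x\<close> itself.\<close>

lemma deg_in_complement:
  assumes "finite V" "E \<subseteq> all_pairs V" "S \<subseteq> V" "x \<in> S"
  shows "deg_in E S x + deg_in (complement_edges V E) S x + 1 = card S"
proof -
  let ?P = "{u \<in> S. {x, u} \<in> E}" and ?Q = "{u \<in> S. {x, u} \<in> complement_edges V E}"
  have fin: "finite S" using assms finite_subset by blast
  have eq: "S - {x} = ?P \<union> ?Q"
    using assms by (fastforce simp: complement_edges_def all_pairs_def card_2_iff)
  have "?P \<inter> ?Q = {}" by (auto simp: complement_edges_def)
  then have "card (S - {x}) = card ?P + card ?Q"
    unfolding eq using fin by (intro card_Un_disjoint) auto
  moreover have "card (S - {x}) + 1 = card S"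
    using fin assms(4) by (metis Suc_eq_plus1 card_Suc_Diff1)
  ultimately show ?thesis by (simp add: deg_in_def)
qed

text \<open>Substituting \<open>d(x) = |V| - 3\<close> and \<open>d_S(x) = |S| - 1 - f_S(x)\<close>
  into \<open>2 d_S(x) >= d(x)\<close> and clearing signs gives these inequalities. With
  \<open>card V \<ge> 3\<close> the subtraction on naturals is exact.\<close>

lemma internal_partition_iff_complement:
  assumes "finite V" "E \<subseteq> all_pairs V" "k_regular V E (card V - 3)" "card V \<ge> 3"
    and AB: "A \<union> B = V" "A \<inter> B = {}" "A \<noteq> {}" "B \<noteq> {}"
  defines "F \<equiv> complement_edges V E"
  shows "internal_partition V E A B \<longleftrightarrow>
    (\<forall>x\<in>A. card B + 2 * deg_in F A x \<le> card A + 1) \<and>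
    (\<forall>x\<in>B. card A + 2 * deg_in F B x \<le> card B + 1)"
proof -
  have card: "card V = card A + card B"
    using assms(1) AB by (metis card_Un_disjoint finite_Un)
  have *: "real (deg_in E S x) \<ge> real (deg_in E V x) / 2
      \<longleftrightarrow> card T + 2 * deg_in F S x \<le> card S + 1"
    if "S \<subseteq> V" "x \<in> S" "card V = card S + card T" for S T x
  proof -
    have "deg_in E V x = card V - 3"
      using assms(3) that by (auto simp: k_regular_def)
    moreover have "deg_in E S x + deg_in F S x + 1 = card S"
      unfolding F_def using deg_in_complement[OF assms(1,2) that(1,2)] .
    ultimately show ?thesis using that(3) \<open>card V \<ge> 3\<close> by linarith
  qed
  show ?thesis
    unfolding internal_partition_def
    using AB *[of A _ B] *[of B _ A] card by auto
qed

section \<open>Edges of a cycle given by a vertex sequence\<close>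

lemma mem_cycle_edges_iff:
  "e \<in> cycle_edges vs \<longleftrightarrow> (\<exists>i<length vs. e = {vs ! i, vs ! (Suc i mod length vs)})"
  by (auto simp: cycle_edges_def)

lemma Suc_mod_eq:
  assumes "i < n"
  shows "Suc i mod n = (if Suc i = n then 0 else Suc i)"
  using assms by simp

lemma Union_cycle_edges: "\<Union>(cycle_edges vs) = set vs"
proof
  show "\<Union>(cycle_edges vs) \<subseteq> set vs"
  proof
    fix x assume "x \<in> \<Union>(cycle_edges vs)"
    then obtain i where i: "i < length vs" "x = vs ! i \<or> x = vs ! (Suc i mod length vs)"
      by (auto simp: mem_cycle_edges_iff)
    then have "Suc i mod length vs < length vs" by (intro mod_less_divisor) linarith
    with i show "x \<in> set vs" by auto
  qed
  show "set vs \<subseteq> \<Union>(cycle_edges vs)"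
  proof
    fix x assume "x \<in> set vs"
    then obtain i where "i < length vs" "x = vs ! i" by (auto simp: in_set_conv_nth)
    then have "{x, vs ! (Suc i mod length vs)} \<in> cycle_edges vs"
      by (auto simp: mem_cycle_edges_iff)
    then show "x \<in> \<Union>(cycle_edges vs)" by blast
  qed
qed

text \<open>Two indices can give the same edge only if each is the cyclic successor of the other,
  which length at least 3 excludes.\<close>

lemma card_cycle_edges:
  assumes "distinct vs" "3 \<le> length vs"
  shows "card (cycle_edges vs) = length vs"
proof -
  let ?e = "\<lambda>i. {vs ! i, vs ! (Suc i mod length vs)}"
  have "inj_on ?e {..<length vs}"
  proof (rule inj_onI)
    fix i j assume ij: "i \<in> {..<length vs}" "j \<in> {..<length vs}" and eq: "?e i = ?e j"
    have lt: "Suc i mod length vs < length vs" "Suc j mod length vs < length vs"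
      using assms by (auto intro!: mod_less_divisor)
    have "i = j \<or> i = Suc j mod length vs \<and> Suc i mod length vs = j"
      using eq ij lt assms(1) by (auto simp: doubleton_eq_iff nth_eq_iff_index_eq)
    then show "i = j"
      using ij assms(2) by (auto simp: Suc_mod_eq split: if_splits)
  qed
  moreover have "cycle_edges vs = ?e ` {..<length vs}"
    by (auto simp: cycle_edges_def)
  ultimately show ?thesis by (simp add: card_image)
qed

text \<open>The cyclic successor and predecessor are distinct from length 3 on. In a 2-regular graph
  they exhaust the neighbours of \<open>x\<close>.\<close>

lemma cycle_edges_two_neighbours:
  assumes "distinct vs" "3 \<le> length vs" "x \<in> set vs"
  shows "\<exists>y z. y \<noteq> z \<and> {x, y} \<in> cycle_edges vs \<and> {x, z} \<in> cycle_edges vs"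
proof -
  obtain i where i: "i < length vs" "x = vs ! i" using assms(3) by (auto simp: in_set_conv_nth)
  define s where "s = Suc i mod length vs"
  define p where "p = (if i = 0 then length vs - 1 else i - 1)"
  have p: "p < length vs" "Suc p mod length vs = i" and s: "s < length vs" "s \<noteq> p"
    using i assms(2) by (auto simp: p_def s_def Suc_mod_eq)
  have "vs ! s \<noteq> vs ! p" using p s assms(1) by (simp add: nth_eq_iff_index_eq)
  moreover have "{x, vs ! s} \<in> cycle_edges vs"
    using i by (auto simp: mem_cycle_edges_iff s_def)
  moreover have "{x, vs ! p} \<in> cycle_edges vs"
    unfolding mem_cycle_edges_iff using p i(2) by (intro exI[of _ p]) auto
  ultimately show ?thesis by blast
qed

section \<open>The alternating colouring of one cycle\<close>

definition odd_places :: "'a list \<Rightarrow> 'a set" where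
  "odd_places vs = {vs ! i |i. i < length vs \<and> odd i}"

text \<open>Indices start at 0, so on an odd cycle this is the larger class, containing the surplus
  vertex.\<close>

definition even_places :: "'a list \<Rightarrow> 'a set" where
  "even_places vs = {vs ! i |i. i < length vs \<and> even i}"

lemma places_Un: "odd_places vs \<union> even_places vs = set vs"
  unfolding odd_places_def even_places_def set_conv_nth by blast

lemma places_Int:
  assumes "distinct vs"
  shows "odd_places vs \<inter> even_places vs = {}"
  using assms by (auto simp: odd_places_def even_places_def nth_eq_iff_index_eq)

lemma card_odd_less: "card {i. i < n \<and> odd i} = n div 2" for n :: nat
proof (induction n)
  case (Suc n)
  have "{i. i < Suc n \<and> odd i} = (if odd n then insert n {i. i < n \<and> odd i} else {i. i < n \<and> odd i})"
    by (auto simp: less_Suc_eq)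
  then show ?case using Suc by auto
qed simp

lemma card_odd_places:
  assumes "distinct vs"
  shows "card (odd_places vs) = length vs div 2"
proof -
  have "odd_places vs = (!) vs ` {i. i < length vs \<and> odd i}"
    by (auto simp: odd_places_def)
  moreover have "inj_on ((!) vs) {i. i < length vs \<and> odd i}"
    using assms by (auto simp: inj_on_def nth_eq_iff_index_eq)
  ultimately show ?thesis by (simp add: card_image card_odd_less)
qed

lemma card_even_places:
  assumes "distinct vs"
  shows "card (even_places vs) = length vs div 2 + length vs mod 2"
proof -
  have fin: "finite (odd_places vs)" "finite (even_places vs)"
    by (metis places_Un finite_Un List.finite_set)+
  have "card (odd_places vs) + card (even_places vs) = length vs"
    using card_Un_disjoint[OF fin places_Int[OF assms]] assms
    by (simp add: places_Un distinct_card)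
  then show ?thesis unfolding card_odd_places[OF assms] by presburger
qed

text \<open>Parity changes along every edge except possibly the closing one, and that edge ends at
  index 0, which is even. So the odd places are independent whatever the length.\<close>

lemma cycle_edges_odd_places:
  assumes "distinct vs" "{x, y} \<in> cycle_edges vs" "x \<in> odd_places vs"
  shows "y \<in> even_places vs"
proof -
  obtain i where i: "i < length vs" "{x, y} = {vs ! i, vs ! (Suc i mod length vs)}"
    using assms(2) by (auto simp: mem_cycle_edges_iff)
  obtain j where j: "j < length vs" "x = vs ! j" "odd j"
    using assms(3) by (auto simp: odd_places_def)
  define s where "s = Suc i mod length vs"
  have s: "s < length vs" "s = (if Suc i = length vs then 0 else Suc i)"
    using i(1) by (auto simp: s_def Suc_mod_eq)
  have par: "odd i \<Longrightarrow> even s" "odd s \<Longrightarrow> even i"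
    using s(2) by (auto split: if_splits)
  have "x = vs ! i \<and> y = vs ! s \<or> x = vs ! s \<and> y = vs ! i"
    using i(2) by (auto simp: s_def doubleton_eq_iff)
  then have "j = i \<and> y = vs ! s \<or> j = s \<and> y = vs ! i"
    using j i(1) s(1) assms(1) by (auto simp: nth_eq_iff_index_eq)
  then obtain k where "k < length vs" "even k" "y = vs ! k"
    using j(3) s(1) i(1) par by metis
  then show ?thesis by (auto simp: even_places_def)
qed

text \<open>For even length the last index is odd, so the closing edge changes parity as
  well.\<close>

lemma cycle_edges_even_places:
  assumes "distinct vs" "even (length vs)" "{x, y} \<in> cycle_edges vs" "x \<in> even_places vs"
  shows "y \<in> odd_places vs"
proof -
  obtain i where i: "i < length vs" "{x, y} = {vs ! i, vs ! (Suc i mod length vs)}"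
    using assms(3) by (auto simp: mem_cycle_edges_iff)
  obtain j where j: "j < length vs" "x = vs ! j" "even j"
    using assms(4) by (auto simp: even_places_def)
  define s where "s = Suc i mod length vs"
  have s: "s < length vs" "s = (if Suc i = length vs then 0 else Suc i)"
    using i(1) by (auto simp: s_def Suc_mod_eq)
  have par: "odd s \<longleftrightarrow> even i"
    using s(2) assms(2) by (metis even_Suc even_zero)
  have "x = vs ! i \<and> y = vs ! s \<or> x = vs ! s \<and> y = vs ! i"
    using i(2) by (auto simp: s_def doubleton_eq_iff)
  then have "j = i \<and> y = vs ! s \<or> j = s \<and> y = vs ! i"
    using j i(1) s(1) assms(1) by (auto simp: nth_eq_iff_index_eq)
  then obtain k where "k < length vs" "odd k" "y = vs ! k"
    using j(3) s(1) i(1) par by metis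
  then show ?thesis by (auto simp: odd_places_def)
qed

text \<open>The successor serves, except at the last index, where the predecessor does; the length
  bound keeps that index away from 0. Hence, even on an odd cycle, a vertex in the larger class has
  at most one neighbour in its own class.\<close>

lemma even_places_neighbour:
  assumes "3 \<le> length vs" "x \<in> even_places vs"
  shows "\<exists>y\<in>odd_places vs. {x, y} \<in> cycle_edges vs"
proof -
  obtain i where i: "i < length vs" "x = vs ! i" "even i"
    using assms(2) by (auto simp: even_places_def)
  show ?thesis
  proof (cases "Suc i < length vs")
    case True
    then have "{x, vs ! Suc i} \<in> cycle_edges vs"
      unfolding mem_cycle_edges_iff using i by (intro exI[of _ i]) auto
    moreover have "vs ! Suc i \<in> odd_places vs"
      unfolding odd_places_def using i True by (intro CollectI exI[of _ "Suc i"]) auto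
    ultimately show ?thesis by blast
  next
    case False
    then obtain j where j: "i = Suc j" using i assms(1) by (cases i) auto
    then have "{x, vs ! j} \<in> cycle_edges vs"
      unfolding mem_cycle_edges_iff using i by (intro exI[of _ j]) (auto simp: insert_commute)
    moreover have "vs ! j \<in> odd_places vs"
      unfolding odd_places_def using i j by (intro CollectI exI[of _ j]) auto
    ultimately show ?thesis by blast
  qed
qed

text \<open>Without such an edge, membership in \<open>A\<close> would alternate with the index. The
  last index is even, so the closing edge would join two vertices on the same side.\<close>

lemma odd_cycle_monochromatic_edge:
  assumes "odd (length vs)"
  shows "\<exists>x y. {x, y} \<in> cycle_edges vs \<and> (x \<in> A \<longleftrightarrow> y \<in> A)"
proof (rule ccontr)
  assume "\<not> ?thesis"
  then have alt: "vs ! i \<in> A \<longleftrightarrow> vs ! (Suc i mod length vs) \<notin> A" if "i < length vs" for i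
    using that unfolding mem_cycle_edges_iff by blast
  have par: "i < length vs \<Longrightarrow> (vs ! i \<in> A) = (even i = (vs ! 0 \<in> A))" for i
  proof (induction i)
    case (Suc i)
    then show ?case using alt[of i] by auto
  qed simp
  obtain m where m: "length vs = Suc m" "even m"
    using assms by (cases "length vs") auto
  show False using alt[of m] par[of m] m by simp
qed

section \<open>Cycle decomposition of a 2-regular graph\<close>

locale two_regular_graph =
  fixes V :: "'a set" and F :: "'a set set"
  assumes finite_vertices: "finite V"
    and edges: "F \<subseteq> all_pairs V"
    and regular: "k_regular V F 2"
begin

lemma edge_ends:
  assumes "{x, y} \<in> F"
  shows "x \<in> V" "y \<in> V" "x \<noteq> y"
  using assms edges by (auto simp: all_pairs_def card_2_iff doubleton_eq_iff)

lemma edge_obtains: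
  assumes "e \<in> F"
  obtains x y where "e = {x, y}" "x \<noteq> y" "x \<in> V" "y \<in> V"
  using assms edges by (auto simp: all_pairs_def card_2_iff)

lemma card_neighbours:
  assumes "x \<in> V"
  shows "card {u \<in> V. {x, u} \<in> F} = 2"
  using regular assms by (auto simp: k_regular_def deg_in_def)

lemma no_three_neighbours:
  assumes "{x, a} \<in> F" "{x, b} \<in> F" "{x, c} \<in> F" "a \<noteq> b"
  shows "c = a \<or> c = b"
proof -
  have "x \<in> V" using assms(1) edge_ends by blast
  then have "card {u \<in> V. {x, u} \<in> F} = 2" by (rule card_neighbours)
  then obtain p q where "{u \<in> V. {x, u} \<in> F} = {p, q}" by (auto simp: card_2_iff)
  moreover have "a \<in> {u \<in> V. {x, u} \<in> F}" "b \<in> {u \<in> V. {x, u} \<in> F}" "c \<in> {u \<in> V. {x, u} \<in> F}"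
    using assms edge_ends by auto
  ultimately show ?thesis using assms(4) by auto
qed

text \<open>The cycle already provides two neighbours of \<open>x\<close>, and \<open>x\<close> has
  no third.\<close>

lemma cycle_saturated:
  assumes "cycle_of F C" "x \<in> \<Union>C" "{x, y} \<in> F"
  shows "{x, y} \<in> C"
proof -
  obtain vs where vs: "distinct vs" "3 \<le> length vs" "C = cycle_edges vs" and "C \<subseteq> F"
    using assms(1) by (auto simp: cycle_of_def)
  moreover have "x \<in> set vs" using assms(2) vs(3) Union_cycle_edges by metis
  ultimately obtain a b where "a \<noteq> b" "{x, a} \<in> C" "{x, b} \<in> C"
    using cycle_edges_two_neighbours by metis
  then show ?thesis
    using no_three_neighbours[of x a b y] assms(3) \<open>C \<subseteq> F\<close> by auto
qed

text \<open>Walk around \<open>D\<close> from the common vertex: by saturation each edge traversed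
  lies in \<open>C\<close>, so the next vertex is again on \<open>C\<close>.\<close>

lemma cycle_subset_if_meet:
  assumes "cycle_of F C" "cycle_of F D" "x \<in> \<Union>C" "x \<in> \<Union>D"
  shows "D \<subseteq> C"
proof -
  obtain vs where vs: "D = cycle_edges vs" and DF: "D \<subseteq> F"
    using assms(2) by (auto simp: cycle_of_def)
  let ?n = "length vs"
  obtain k where k: "k < ?n" "vs ! k \<in> \<Union>C"
    using assms(3,4) vs Union_cycle_edges by (metis in_set_conv_nth)
  have edge: "{vs ! i, vs ! (Suc i mod ?n)} \<in> C" if "i < ?n" "vs ! i \<in> \<Union>C" for i
  proof -
    have "{vs ! i, vs ! (Suc i mod ?n)} \<in> F"
      using that(1) DF vs mem_cycle_edges_iff by blast
    then show ?thesis by (rule cycle_saturated[OF assms(1) that(2)])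
  qed
  have shift: "vs ! ((k + j) mod ?n) \<in> \<Union>C" for j
  proof (induction j)
    case 0
    then show ?case using k by simp
  next
    case (Suc j)
    have "(k + j) mod ?n < ?n" using k(1) by (intro mod_less_divisor) linarith
    from edge[OF this Suc.IH] have "vs ! (Suc ((k + j) mod ?n) mod ?n) \<in> \<Union>C" by blast
    then show ?case by (simp add: mod_Suc_eq)
  qed
  \<comment> \<open>The offset \<open>i + ?n - k\<close> leads from \<open>k\<close> to
    \<open>i\<close> modulo \<open>?n\<close>; adding \<open>?n\<close> first keeps the subtraction
    exact.\<close>
  have "vs ! i \<in> \<Union>C" if "i < ?n" for i
    using shift[of "i + ?n - k"] that k(1) by simp
  then show ?thesis using edge vs by (auto simp: mem_cycle_edges_iff)
qed

lemma cycles_disjoint: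
  assumes "cycle_of F C" "cycle_of F D" "C \<noteq> D"
  shows "\<Union>C \<inter> \<Union>D = {}"
  using cycle_subset_if_meet assms by blast

text \<open>Take a longest path starting at \<open>v\<close>. Its last vertex has all neighbours on
  the path, one of them not its predecessor. An interior vertex has no edge to spare, so this
  neighbour is \<open>v\<close>, and the path closes up to a cycle.\<close>

lemma vertex_on_cycle:
  assumes "v \<in> V"
  shows "\<exists>C. cycle_of F C \<and> v \<in> \<Union>C"
proof -
  define path where "path vs \<longleftrightarrow> distinct vs \<and> vs \<noteq> [] \<and> vs ! 0 = v \<and> set vs \<subseteq> V \<and>
    (\<forall>i. Suc i < length vs \<longrightarrow> {vs ! i, vs ! Suc i} \<in> F)" for vs
  have "path [v]" using assms by (simp add: path_def)
  moreover have "length vs < Suc (card V)" if "path vs" for vs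
    using that finite_vertices by (metis path_def card_mono distinct_card le_imp_less_Suc)
  ultimately obtain vs where vs: "path vs" and max: "\<And>ws. path ws \<Longrightarrow> length ws \<le> length vs"
    using ex_has_greatest_nat[of path "[v]" length "Suc (card V)"] by (metis less_imp_le)
  obtain m where m: "length vs = Suc m" using vs by (cases vs) (auto simp: path_def)
  define x where "x = vs ! m"
  have dist: "distinct vs" and step: "\<And>i. Suc i < length vs \<Longrightarrow> {vs ! i, vs ! Suc i} \<in> F"
    using vs by (auto simp: path_def)
  have "x \<in> V" using vs m by (auto simp: path_def x_def)
  have on_path: "u \<in> set vs" if "{x, u} \<in> F" for u
  proof (rule ccontr)
    assume "u \<notin> set vs"
    then have "path (vs @ [u])"
      using vs m that edge_ends[OF that]
      by (auto simp: path_def nth_append x_def less_Suc_eq)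
    then show False using max by fastforce
  qed
  obtain a b where ab: "a \<noteq> b" "{x, a} \<in> F" "{x, b} \<in> F"
    using card_neighbours[OF \<open>x \<in> V\<close>] by (auto simp: card_2_iff set_eq_iff)
  have "\<exists>u. {x, u} \<in> F \<and> u \<noteq> vs ! (m - 1)" using ab by metis
  then obtain u where u: "{x, u} \<in> F" "u \<noteq> vs ! (m - 1)" by blast
  obtain j where j: "j < length vs" "u = vs ! j"
    using on_path[OF u(1)] by (auto simp: in_set_conv_nth)
  have "j \<noteq> m" using edge_ends(3)[OF u(1)] j(2) x_def by blast
  moreover have "j \<noteq> m - 1" using u(2) j(2) by blast
  \<comment> \<open>This also disposes of a path with one vertex: for \<open>m = 0\<close> the
    condition \<open>j \<noteq> m\<close> leaves no index.\<close>
  ultimately have jm: "Suc j < m" using j(1) m by linarith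
  have "j = 0"
  proof (rule ccontr)
    assume "j \<noteq> 0"
    then obtain i where i: "j = Suc i" using not0_implies_Suc by blast
    \<comment> \<open>An interior \<open>u\<close> would have three distinct neighbours: its
      predecessor, its successor and \<open>x\<close>.\<close>
    have "{u, vs ! i} \<in> F" "{u, vs ! Suc j} \<in> F" "{u, x} \<in> F"
      using step[of i] step[of j] i j jm m u(1) by (auto simp: insert_commute)
    moreover have "vs ! i \<noteq> vs ! Suc j" "x \<noteq> vs ! i" "x \<noteq> vs ! Suc j"
      using dist i jm m by (auto simp: x_def nth_eq_iff_index_eq)
    ultimately show False using no_three_neighbours by metis
  qed
  then have len: "3 \<le> length vs" using jm m by linarith
  have "{vs ! i, vs ! (Suc i mod length vs)} \<in> F" if "i < length vs" for i
  proof (cases "Suc i = length vs")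
    case True
    then show ?thesis using u(1) j(2) \<open>j = 0\<close> m by (simp add: x_def)
  next
    case False
    then show ?thesis using step[of i] that by simp
  qed
  then have "cycle_edges vs \<subseteq> F" by (auto simp: mem_cycle_edges_iff)
  then have "cycle_of F (cycle_edges vs)" using dist len by (auto simp: cycle_of_def)
  moreover have "v \<in> \<Union>(cycle_edges vs)"
    using vs unfolding Union_cycle_edges path_def by (metis length_greater_0_conv nth_mem)
  ultimately show ?thesis by blast
qed

lemma Union_cycles: "\<Union>{C. cycle_of F C} = F"
proof
  show "\<Union>{C. cycle_of F C} \<subseteq> F" by (auto simp: cycle_of_def)
  show "F \<subseteq> \<Union>{C. cycle_of F C}"
  proof
    fix e assume "e \<in> F"
    then obtain x y where e: "e = {x, y}" "x \<in> V" by (rule edge_obtains)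
    obtain C where C: "cycle_of F C" "x \<in> \<Union>C" using vertex_on_cycle[OF e(2)] by blast
    then show "e \<in> \<Union>{C. cycle_of F C}" using cycle_saturated \<open>e \<in> F\<close> e(1) by blast
  qed
qed

lemma Union_cycle_vertices: "(\<Union>C\<in>{C. cycle_of F C}. \<Union>C) = V"
proof
  show "(\<Union>C\<in>{C. cycle_of F C}. \<Union>C) \<subseteq> V"
    using edges by (auto simp: cycle_of_def all_pairs_def)
  show "V \<subseteq> (\<Union>C\<in>{C. cycle_of F C}. \<Union>C)" using vertex_on_cycle by blast
qed

lemma disjoint_union_of_cycles: "disjoint_union_of_cycles V F"
  unfolding disjoint_union_of_cycles_def
proof (intro exI[of _ "{C. cycle_of F C}"] conjI)
  show "\<forall>C\<in>{C. cycle_of F C}. cycle_of F C" by simp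
  show "pairwise (\<lambda>C D. disjnt (\<Union>C) (\<Union>D)) {C. cycle_of F C}"
    using cycles_disjoint by (auto simp: pairwise_def disjnt_def)
  show "\<Union>{C. cycle_of F C} = F" by (rule Union_cycles)
  show "\<Union>(\<Union>{C. cycle_of F C}) = V" using Union_cycle_vertices by blast
qed

section \<open>Odd cycles versus the two sides of a partition\<close>

lemma deg_in_partition:
  assumes "A \<union> B = V" "A \<inter> B = {}" "x \<in> V"
  shows "deg_in F A x + deg_in F B x = 2"
proof -
  have "finite A" "finite B" using assms(1) finite_vertices by (metis finite_Un)+
  then show ?thesis
    using deg_in_Un[of A B F x] assms regular by (simp add: k_regular_def)
qed

text \<open>Two odd cycles would yield disjoint edges inside \<open>B\<close>, whose four ends
  contribute at least 4 to a degree sum that is at most 2. Only \<open>A\<close> is assumed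
  independent, so the lemma can be applied with either side in that role.\<close>

lemma at_most_one_odd_cycle:
  assumes AB: "A \<union> B = V" "A \<inter> B = {}" and le: "card B \<le> card A + 1"
    and indep: "\<And>x. x \<in> A \<Longrightarrow> deg_in F A x = 0"
  shows "\<exists>\<^sub>\<le>\<^sub>1C. odd_cycle_of F C"
  unfolding Uniq_def
proof (intro allI impI)
  fix C D assume C: "odd_cycle_of F C" and D: "odd_cycle_of F D"
  have fin: "finite A" "finite B" using AB(1) finite_vertices by (metis finite_Un)+
  have "(\<Sum>x\<in>A. deg_in F B x) = (\<Sum>x\<in>A. 2)"
    using deg_in_partition[OF AB] indep AB(1) by (intro sum.cong) force+
  then have "(\<Sum>y\<in>B. deg_in F A y) = 2 * card A"
    by (simp add: sum_deg_in_commute[OF fin])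
  moreover have "(\<Sum>y\<in>B. deg_in F A y + deg_in F B y) = (\<Sum>y\<in>B. 2)"
    using deg_in_partition[OF AB] AB(1) by (intro sum.cong) auto
  ultimately have sum: "(\<Sum>y\<in>B. deg_in F B y) \<le> 2"
    using le by (simp add: sum.distrib)
  have mono: "\<exists>x y. {x, y} \<in> X \<and> x \<in> B \<and> y \<in> B \<and> x \<noteq> y" if X: "odd_cycle_of F X" for X
  proof -
    obtain vs where vs: "distinct vs" "3 \<le> length vs" "X = cycle_edges vs" "X \<subseteq> F" "odd (card X)"
      using X by (auto simp: odd_cycle_of_def cycle_of_def)
    then have "odd (length vs)" by (simp add: card_cycle_edges)
    then obtain x y where xy: "{x, y} \<in> X" "x \<in> A \<longleftrightarrow> y \<in> A"
      using odd_cycle_monochromatic_edge vs(3) by metis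
    have F: "{x, y} \<in> F" using xy(1) vs(4) by blast
    have "\<not> (x \<in> A \<and> y \<in> A)"
      using indep[of x] deg_in_pos[OF fin(1) _ F] by auto
    then show ?thesis using xy edge_ends[OF F] AB(1) by auto
  qed
  obtain a b where ab: "{a, b} \<in> C" "a \<in> B" "b \<in> B" "a \<noteq> b" using mono[OF C] by blast
  obtain c d where cd: "{c, d} \<in> D" "c \<in> B" "d \<in> B" "c \<noteq> d" using mono[OF D] by blast
  show "C = D"
  proof (rule ccontr)
    assume "C \<noteq> D"
    then have disj: "\<Union>C \<inter> \<Union>D = {}" using cycles_disjoint C D by (auto simp: odd_cycle_of_def)
    have "{a, b} \<inter> {c, d} = {}" using ab(1) cd(1) disj by blast
    then have "card {a, b, c, d} = 4" using ab(4) cd(4) by auto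
    moreover have "{a, b} \<in> F" "{c, d} \<in> F"
      using ab(1) cd(1) C D by (auto simp: odd_cycle_of_def cycle_of_def)
    then have "1 \<le> deg_in F B y" if "y \<in> {a, b, c, d}" for y
      using that ab cd deg_in_pos[OF fin(2)] by (fastforce simp: insert_commute Suc_le_eq)
    then have "(\<Sum>y\<in>{a, b, c, d}. 1) \<le> (\<Sum>y\<in>{a, b, c, d}. deg_in F B y)"
      by (intro sum_mono)
    moreover have "(\<Sum>y\<in>{a, b, c, d}. deg_in F B y) \<le> (\<Sum>y\<in>B. deg_in F B y)"
      using ab cd fin by (intro sum_mono2) auto
    ultimately show False using sum by simp
  qed
qed

text \<open>The excess \<open>|B| - |A|\<close> is the number of odd cycles, and this number also
  bounds the degrees inside \<open>B\<close>: they vanish on even cycles and are at most 1 on odd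
  ones.\<close>

lemma alternating_partition:
  assumes uniq: "\<exists>\<^sub>\<le>\<^sub>1C. odd_cycle_of F C"
  shows "\<exists>A B. A \<union> B = V \<and> A \<inter> B = {} \<and> card A \<le> card B \<and> card B \<le> card A + 1 \<and>
    (\<forall>x\<in>A. deg_in F A x = 0) \<and> (\<forall>x\<in>B. card A + deg_in F B x \<le> card B)"
proof -
  let ?\<C> = "{C. cycle_of F C}"
  have "\<forall>C\<in>?\<C>. \<exists>vs. distinct vs \<and> 3 \<le> length vs \<and> C = cycle_edges vs"
    by (auto simp: cycle_of_def)
  \<comment> \<open>A cycle is only an edge set, so a vertex ordering \<open>w C\<close> is chosen;
    it fixes which vertex of an odd cycle is surplus.\<close>
  then obtain w where w: "\<And>C. cycle_of F C \<Longrightarrow> distinct (w C)"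
      "\<And>C. cycle_of F C \<Longrightarrow> 3 \<le> length (w C)" "\<And>C. cycle_of F C \<Longrightarrow> C = cycle_edges (w C)"
    by (metis mem_Collect_eq)
  have set_w: "set (w C) = \<Union>C" if "cycle_of F C" for C
    using w(3)[OF that] Union_cycle_edges by metis
  have len_w: "length (w C) = card C" if "cycle_of F C" for C
    using w[OF that] card_cycle_edges by metis
  have finC: "finite ?\<C>"
  proof (rule finite_subset)
    show "?\<C> \<subseteq> Pow (Pow V)" using edges by (auto simp: cycle_of_def all_pairs_def)
    show "finite (Pow (Pow V))" using finite_vertices by simp
  qed
  define A where "A = (\<Union>C\<in>?\<C>. odd_places (w C))"
  define B where "B = (\<Union>C\<in>?\<C>. even_places (w C))"
  have sub: "odd_places (w C) \<subseteq> \<Union>C" "even_places (w C) \<subseteq> \<Union>C" if "cycle_of F C" for C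
    using places_Un[of "w C"] set_w[OF that] by auto
  have AB: "A \<union> B = V"
  proof -
    have "A \<union> B = (\<Union>C\<in>?\<C>. \<Union>C)"
      unfolding A_def B_def UN_Un_distrib[symmetric]
      by (intro SUP_cong) (simp_all add: places_Un set_w)
    then show ?thesis using Union_cycle_vertices by simp
  qed
  have disj: "A \<inter> B = {}"
  proof (rule ccontr)
    assume "A \<inter> B \<noteq> {}"
    then obtain x C D where x: "cycle_of F C" "cycle_of F D" "x \<in> odd_places (w C)" "x \<in> even_places (w D)"
      by (auto simp: A_def B_def)
    then have "x \<in> \<Union>C \<inter> \<Union>D" using sub(1)[of C] sub(2)[of D] by blast
    then have "C = D" using cycles_disjoint[OF x(1,2)] by blast
    then show False using x places_Int[OF w(1)] by blast
  qed
  have fin: "finite A" "finite B" using AB finite_vertices by (metis finite_Un)+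
  have card_UN: "card (\<Union>C\<in>?\<C>. P C) = (\<Sum>C\<in>?\<C>. card (P C))"
    if P: "\<And>C. cycle_of F C \<Longrightarrow> P C \<subseteq> \<Union>C" for P
  proof (rule card_UN_disjoint[OF finC])
    have "finite (P C)" if "cycle_of F C" for C
      using finite_subset[OF P[OF that]] set_w[OF that] List.finite_set[of "w C"] by simp
    then show "\<forall>C\<in>?\<C>. finite (P C)" by blast
    have "P C \<inter> P D = {}" if "cycle_of F C" "cycle_of F D" "C \<noteq> D" for C D
      using P[OF that(1)] P[OF that(2)] cycles_disjoint[OF that] by blast
    then show "\<forall>C\<in>?\<C>. \<forall>D\<in>?\<C>. C \<noteq> D \<longrightarrow> P C \<inter> P D = {}"
      by simp
  qed
  let ?O = "{C \<in> ?\<C>. odd (card C)}"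
  have "card A = (\<Sum>C\<in>?\<C>. card C div 2)"
    unfolding A_def by (subst card_UN) (simp_all add: sub card_odd_places w(1) len_w)
  moreover have "card B = (\<Sum>C\<in>?\<C>. card C div 2 + card C mod 2)"
    unfolding B_def by (subst card_UN) (simp_all add: sub card_even_places w(1) len_w)
  moreover have "(\<Sum>C\<in>?\<C>. card C mod 2) = card ?O"
  proof -
    have "(\<Sum>C\<in>?\<C>. card C mod 2) = (\<Sum>C\<in>?\<C>. if odd (card C) then 1 else 0)"
      by (intro sum.cong) (auto simp: odd_iff_mod_2_eq_one)
    also have "\<dots> = card ?O" using finC by (simp add: sum.If_cases Int_def)
    finally show ?thesis .
  qed
  ultimately have cB: "card B = card A + card ?O" by (simp add: sum.distrib)
  have O1: "card ?O \<le> 1"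
    using uniq finC unfolding Uniq_def odd_cycle_of_def
    by (simp add: card_le_Suc0_iff_eq)
  have edge_w: "{x, y} \<in> cycle_edges (w C)" if "cycle_of F C" "x \<in> \<Union>C" "{x, y} \<in> F" for x y C
    using cycle_saturated[OF that] w(3)[OF that(1)] by simp
  have A0: "deg_in F A x = 0" if xA: "x \<in> A" for x
  proof -
    obtain C where C: "cycle_of F C" "x \<in> odd_places (w C)" using xA by (auto simp: A_def)
    have xC: "x \<in> \<Union>C" using sub(1)[OF C(1)] C(2) by blast
    have "y \<in> B" if "{x, y} \<in> F" for y
      using cycle_edges_odd_places[OF w(1)[OF C(1)] edge_w[OF C(1) xC that] C(2)] C(1)
      by (auto simp: B_def)
    then have "{u \<in> A. {x, u} \<in> F} = {}" using disj by blast
    then show ?thesis by (simp only: deg_in_def card.empty)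
  qed
  have B1: "deg_in F B x \<le> card ?O" if xB: "x \<in> B" for x
  proof -
    obtain C where C: "cycle_of F C" "x \<in> even_places (w C)" using xB by (auto simp: B_def)
    have xC: "x \<in> \<Union>C" using sub(2)[OF C(1)] C(2) by blast
    show ?thesis
    proof (cases "odd (card C)")
      case True
      then have "card ?O > 0" using C(1) finC by (auto simp: card_gt_0_iff)
      moreover obtain y where y: "y \<in> odd_places (w C)" "{x, y} \<in> cycle_edges (w C)"
        using even_places_neighbour[OF w(2)[OF C(1)] C(2)] by blast
      have "y \<in> A" using y(1) C(1) by (auto simp: A_def)
      moreover have "{x, y} \<in> F"
        using y(2) C(1) unfolding w(3)[OF C(1), symmetric] cycle_of_def by blast
      ultimately have "deg_in F A x > 0" using deg_in_pos[OF fin(1)] by blast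
      then have "deg_in F B x \<le> 1" using deg_in_partition[OF AB disj, of x] xB AB by auto
      then show ?thesis using \<open>card ?O > 0\<close> by linarith
    next
      case False
      then have ev: "even (length (w C))" by (simp add: len_w C(1))
      have "y \<in> A" if "{x, y} \<in> F" for y
        using cycle_edges_even_places[OF w(1)[OF C(1)] ev edge_w[OF C(1) xC that] C(2)] C(1)
        by (auto simp: A_def)
      then have "{u \<in> B. {x, u} \<in> F} = {}" using disj by blast
      then have "deg_in F B x = 0" by (simp only: deg_in_def card.empty)
      then show ?thesis by simp
    qed
  qed
  show ?thesis
    using AB disj cB O1 A0 B1 by (intro exI[of _ A] exI[of _ B]) auto
qed

end

theorem theorem3:
  fixes V :: "'a set" and E :: "'a set set" and n :: nat
  assumes "simple_graph V E"
    and "card V = n"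
    and "n \<ge> 3"
    and "k_regular V E (n - 3)"
  shows "k_regular V (complement_edges V E) 2
    \<and> disjoint_union_of_cycles V (complement_edges V E)
    \<and> ((\<exists>A B. internal_partition V E A B) \<longleftrightarrow>
         (\<exists>\<^sub>\<le>\<^sub>1C. odd_cycle_of (complement_edges V E) C))
    \<and> ((\<exists>\<^sub>\<le>\<^sub>1C. odd_cycle_of (complement_edges V E) C) \<longrightarrow>
         (\<exists>A B. internal_partition V E A B \<and> near_bisection A B))"
proof -
  let ?F = "complement_edges V E"
  have fin: "finite V" and EV: "E \<subseteq> all_pairs V"
    using assms(1) by (auto simp: simple_graph_def)
  have "deg_in ?F V v = 2" if "v \<in> V" for v
    using deg_in_complement[OF fin EV order_refl that] that assms(2-4)
    by (simp add: k_regular_def)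
  then have reg: "k_regular V ?F 2" by (simp add: k_regular_def)
  interpret two_regular_graph V ?F
    using fin reg by unfold_locales (auto simp: complement_edges_def)
  note iff = internal_partition_iff_complement[OF fin EV]
  have card: "card V = card A + card B" if "A \<union> B = V" "A \<inter> B = {}" for A B
    using that fin by (metis card_Un_disjoint finite_Un)
  have uniq: "\<exists>\<^sub>\<le>\<^sub>1C. odd_cycle_of ?F C" if int: "internal_partition V E A B" for A B
  proof -
    have AB: "A \<union> B = V" "A \<inter> B = {}" "A \<noteq> {}" "B \<noteq> {}"
      using int by (auto simp: internal_partition_def)
    have A: "card B + 2 * deg_in ?F A x \<le> card A + 1" if "x \<in> A" for x
      using iff[OF _ _ AB] int that assms by simp
    have B: "card A + 2 * deg_in ?F B x \<le> card B + 1" if "x \<in> B" for x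
      using iff[OF _ _ AB] int that assms by simp
    \<comment> \<open>Each side has a vertex; dropping the degree term there bounds the other
      side.\<close>
    have le: "card B \<le> card A + 1" "card A \<le> card B + 1" using A B AB(3,4) by fastforce+
    show ?thesis
    proof (cases "card A \<le> card B")
      case True
      \<comment> \<open>Twice the degree is at most 1, hence the degree is 0.\<close>
      then have "deg_in ?F A x = 0" if "x \<in> A" for x using A[OF that] by linarith
      then show ?thesis by (rule at_most_one_odd_cycle[OF AB(1,2) le(1)])
    next
      case False
      then have indep: "deg_in ?F B x = 0" if "x \<in> B" for x using B[OF that] by linarith
      have "B \<union> A = V" "B \<inter> A = {}" using AB by auto
      then show ?thesis using le(2) indep by (rule at_most_one_odd_cycle)
    qed
  qed
  have ex: "\<exists>A B. internal_partition V E A B \<and> near_bisection A B"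
    if one: "\<exists>\<^sub>\<le>\<^sub>1C. odd_cycle_of ?F C"
  proof -
    obtain A B where AB: "A \<union> B = V" "A \<inter> B = {}" "card A \<le> card B" "card B \<le> card A + 1"
      and A: "\<And>x. x \<in> A \<Longrightarrow> deg_in ?F A x = 0"
      and B: "\<And>x. x \<in> B \<Longrightarrow> card A + deg_in ?F B x \<le> card B"
      using alternating_partition[OF one] by auto
    \<comment> \<open>At least three vertices are split into sizes differing by at most one.\<close>
    have "card A > 0" "card B > 0" using card[OF AB(1,2)] AB(3,4) assms(2,3) by linarith+
    then have ne: "A \<noteq> {}" "B \<noteq> {}" by auto
    \<comment> \<open>One copy of the degree is absorbed by \<open>|B| - |A|\<close>; the other is
      at most 1 since that difference is.\<close>
    have "card A + 2 * deg_in ?F B x \<le> card B + 1" if "x \<in> B" for x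
      using B[OF that] AB(4) by linarith
    then have "internal_partition V E A B"
      using iff[OF _ _ AB(1,2) ne] assms A AB(4) by simp
    moreover have "near_bisection A B" using AB(3,4) by (auto simp: near_bisection_def)
    ultimately show ?thesis by blast
  qed
  show ?thesis using reg disjoint_union_of_cycles uniq ex by blast
qed

end
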